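(* Let $q=p^h$ with $p>3$ prime, $h\ge1$, $n\ge2$, $1\le k\le n-1$. Let $c\in C_k(n,q)$ have weight smaller than $2q^k$ with $(c,S)\neq0$ for some $(n-k)$-dimensional subspace $S$. Then every subspace of $PG(n,q)$ that meets $supp(c)$ in at least one point meets it in $1\pmod p$ points.
   Context: $C_k(n,q)$ is the $p$-ary linear code spanned over $\mathbb{F}_p$ by the rows of the incidence matrix of $k$-dimensional subspaces versus points of $PG(n,q)$ (entry $1$ iff the point lies in the subspace); codewords are vectors indexed by points. $supp(c)$ is the set of points with nonzero coordinate, the weight is $|supp(c)|$, and $(c,S)=\sum_{P\in S}c_P\in\mathbb{F}_p$. *)

theory Defs
  imports "HOL-Analysis.Analysis" "HOL-Number_Theory.Cong" "HOL-Computational_Algebra.Primes"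
begin

text \<open>
  The geometry \<open>PG(n,q)\<close> is built on the vector space \<open>'a ^ 'n\<close> with \<open>CARD('a) = q\<close> and
  \<open>CARD('n) = n + 1\<close>; its points are the one-dimensional linear subspaces.
\<close>

typedef (overloaded) ('a::field, 'n::finite) proj_point =
  "{L :: ('a ^ 'n) set. vec.subspace L \<and> vec.dim L = 1}"
proof -
  fix i :: 'n
  have "axis i (1 :: 'a) \<noteq> 0"
    by simp
  then have "vec.dim (vec.span {axis i (1 :: 'a)}) = 1"
    by (subst vec.dim_span, subst vec.dim_eq_card_independent) simp_all
  then show ?thesis
    using vec.subspace_span by blast
qed

instance proj_point :: ("{field, finite}", finite) finite
proof
  have "inj (Rep_proj_point :: ('a, 'b) proj_point \<Rightarrow> _)"
    by (simp add: inj_def Rep_proj_point_inject)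
  then show "finite (UNIV :: ('a, 'b) proj_point set)"
    using finite_imageD finite by blast
qed

definition points_of :: "('a::field ^ 'n::finite) set \<Rightarrow> ('a, 'n) proj_point set" where
  "points_of U = {P. Rep_proj_point P \<subseteq> U}"

text \<open>Projective subspaces are identified with their point sets; the empty subspace is included.\<close>

definition proj_subspaces :: "('a::field, 'n::finite) proj_point set set" where
  "proj_subspaces = {points_of U | U. vec.subspace U}"

text \<open>The projective dimension is one less than the linear dimension.\<close>

definition proj_subspaces_dim :: "nat \<Rightarrow> ('a::field, 'n::finite) proj_point set set" where
  "proj_subspaces_dim k = {points_of U | U. vec.subspace U \<and> vec.dim U = k + 1}"

definition incidence_vec :: "'i::finite set \<Rightarrow> 'f::zero_neq_one ^ 'i" where
  "incidence_vec S = (\<chi> P. if P \<in> S then 1 else 0)"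

text \<open>
  The code \<open>C\<^sub>k(n,q)\<close>; the type \<open>'f\<close> is the field of scalars, to be taken as the field with
  \<open>p\<close> elements.
\<close>

definition subspace_code ::
    "nat \<Rightarrow> ('f::field ^ ('a::{field, finite}, 'n::finite) proj_point) set" where
  "subspace_code k = vec.span (incidence_vec ` proj_subspaces_dim k)"

definition supp :: "'f::zero ^ 'i::finite \<Rightarrow> 'i set" where
  "supp c = {P. c $ P \<noteq> 0}"

definition weight :: "'f::zero ^ 'i::finite \<Rightarrow> nat" where
  "weight c = card (supp c)"

definition sum_on :: "'f::comm_monoid_add ^ 'i::finite \<Rightarrow> 'i set \<Rightarrow> 'f" where
  "sum_on c S = (\<Sum>P\<in>S. c $ P)"

end

theory Submission
  imports "HOL-Algebra.Algebraic_Closure_Type" "HOL-Number_Theory.Residues" Defs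
begin

text \<open>
  All \<open>(n-k)\<close>-spaces take the same value \<open>\<alpha> \<noteq> 0\<close> on \<open>c\<close>. Kernels of linear maps into the field \<open>K\<close>
  with \<open>q\<^sup>k\<close> elements contain \<open>(n-k)\<close>-spaces, and averaging over such maps vanishing on a subspace
  \<open>L\<close> gives an \<open>(n-k)\<close>-space through \<open>L\<close> with at most one point of the support outside \<open>L\<close>, because
  the weight is less than \<open>2q\<^sup>k\<close>. For \<open>L\<close> a point \<open>R\<close> of the support, the polynomial method over \<open>K\<close>
  excludes that the extra point is needed, so \<open>c\<close> equals \<open>\<alpha>\<close> on its support and every \<open>(n-k)\<close>-space
  meets the support in \<open>1\<close> modulo \<open>p\<close> points. For \<open>L\<close> a line, the averaging shows that \<open>L\<close> meets the
  support in \<open>0\<close> or \<open>1\<close> modulo \<open>p\<close> points; if \<open>L\<close> meets the support, the first case produces a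
  line with exactly two points of the support, which is absurd. Larger subspaces are partitioned into
  lines through a point of the support.
\<close>

unbundle no fps_syntax

section \<open>The field with \<open>CARD('a) ^ k\<close> elements\<close>

lemma power_card_field:
  fixes x :: "'a::{field, finite}"
  shows "x ^ CARD('a) = x"
proof (cases "x = 0")
  case False
  have "bij_betw ((*) x) (UNIV - {0}) (UNIV - {0})"
    using False by (intro bij_betwI[where g = "\<lambda>y. y / x"]) auto
  then have "(\<Prod>y\<in>UNIV - {0}. x * y) = \<Prod>(UNIV - {0})"
    by (simp add: prod.reindex_bij_betw[where g = "\<lambda>y. y"])
  then have "x ^ (CARD('a) - 1) = 1"
    by (simp add: prod.distrib)
  then show ?thesis
    by (metis One_nat_def Suc_pred finite_UNIV_card_ge_0 finite mult_1_right power_Suc)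
qed (simp add: zero_power)

lemma CHAR_finite_field:
  assumes "prime p" and "CARD('a::{field, finite}) = p ^ h"
  shows "CHAR('a) = p"
proof -
  have "prime CHAR('a)"
    by (simp add: finite_imp_CHAR_pos prime_CHAR_semidom)
  moreover have "CHAR('a) dvd p ^ h"
    using CHAR_dvd_CARD[where 'a = 'a] assms by simp
  ultimately show ?thesis
    using assms(1) prime_dvd_power primes_dvd_imp_eq by blast
qed

text \<open>For \<open>m\<close> a positive power of the prime characteristic this is a subfield,
  and in an algebraically closed field it has \<open>m\<close> elements. It is a set inside a larger
  field because the order \<open>q ^ k\<close> depends on the variable \<open>k\<close>, on which a
  type cannot depend.\<close>

definition power_fixed :: "nat \<Rightarrow> 'a::field set" where
  "power_fixed m = {x. x ^ m = x}"

context
  fixes m j :: nat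
  assumes pc: "prime CHAR('a::field)" and m: "m = CHAR('a) ^ j" and j: "j \<ge> 1"
begin

lemma power_fixed_gt_1: "m > 1"
  using pc m j by (metis one_less_power less_le_trans prime_gt_1_nat zero_less_one)

lemma power_fixed_of_nat: "of_nat m = (0 :: 'a)"
  using j by (simp add: m zero_power)

lemma power_fixed_add: "x \<in> power_fixed m \<Longrightarrow> y \<in> power_fixed m \<Longrightarrow> x + y \<in> (power_fixed m :: 'a set)"
  using freshmans_dream'[OF pc m] by (simp add: power_fixed_def)

lemma power_fixed_0: "0 \<in> (power_fixed m :: 'a set)"
  using power_fixed_gt_1 by (simp add: power_fixed_def)

lemma power_fixed_uminus: "x \<in> power_fixed m \<Longrightarrow> - x \<in> (power_fixed m :: 'a set)"
proof -
  assume x: "x \<in> power_fixed m"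
  have "x ^ m + (- x) ^ m = 0"
    using freshmans_dream'[OF pc m, of x "- x"] power_fixed_gt_1 by (simp add: zero_power)
  then show ?thesis
    using x by (simp add: power_fixed_def eq_neg_iff_add_eq_0 add.commute)
qed

lemma power_fixed_mult: "x \<in> power_fixed m \<Longrightarrow> y \<in> power_fixed m \<Longrightarrow> x * y \<in> (power_fixed m :: 'a set)"
  by (simp add: power_fixed_def power_mult_distrib)

lemma power_fixed_divide: "x \<in> power_fixed m \<Longrightarrow> y \<in> power_fixed m \<Longrightarrow> x / y \<in> (power_fixed m :: 'a set)"
  by (simp add: power_fixed_def power_divide)

lemma finite_power_fixed: "finite (power_fixed m :: 'a set)"
proof -
  let ?P = "monom 1 m - monom 1 1 :: 'a poly"
  have "coeff ?P m = 1"
    using power_fixed_gt_1 by simp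
  then have "?P \<noteq> 0" by (metis coeff_0 zero_neq_one)
  then have "finite {x. poly ?P x = 0}"
    by (rule poly_roots_finite)
  then show ?thesis
    by (simp add: power_fixed_def poly_monom)
qed

text \<open>For \<open>i > 0\<close> there are at most \<open>i < m - 1\<close> roots of unity of
  order dividing \<open>i\<close>, so some nonzero \<open>g\<close> has
  \<open>g ^ i \<noteq> 1\<close>. Multiplication by \<open>g\<close> permutes the field and scales
  the sum by \<open>g ^ i\<close>. For \<open>i = 0\<close> the sum is \<open>m\<close>, which is
  zero in the field.\<close>

lemma sum_power_power_fixed:
  assumes card: "card (power_fixed m :: 'a set) = m" and i: "i < m - 1"
  shows "(\<Sum>u\<in>power_fixed m. u ^ i) = (0 :: 'a)"
proof (cases "i = 0")
  case True
  then show ?thesis using card power_fixed_of_nat by simp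
next
  case False
  let ?K = "power_fixed m :: 'a set"
  let ?P = "monom 1 i - 1 :: 'a poly"
  have "coeff ?P i = 1"
    using False by simp
  then have P: "?P \<noteq> 0" by (metis coeff_0 zero_neq_one)
  have "degree ?P \<le> i"
    by (simp add: degree_diff_le degree_monom_le)
  then have "card {x. poly ?P x = 0} \<le> i"
    using card_poly_roots_bound[OF P] by simp
  moreover have "card (?K - {0}) = m - 1"
    using card power_fixed_0 finite_power_fixed by simp
  ultimately have "\<not> ?K - {0} \<subseteq> {x. poly ?P x = 0}"
    using i card_mono[OF poly_roots_finite[OF P]] by (metis leD le_trans)
  then obtain g where g: "g \<in> ?K" "g \<noteq> 0" "g ^ i \<noteq> 1"
    by (auto simp: poly_monom)
  have "bij_betw ((*) g) ?K ?K"
    using g power_fixed_mult power_fixed_divide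
    by (intro bij_betwI[where g = "\<lambda>y. y / g"]) auto
  then have "(\<Sum>u\<in>?K. u ^ i) = (\<Sum>u\<in>?K. (g * u) ^ i)"
    by (simp add: sum.reindex_bij_betw[where g = "\<lambda>y. y ^ i"])
  also have "\<dots> = g ^ i * (\<Sum>u\<in>?K. u ^ i)"
    by (simp add: power_mult_distrib sum_distrib_left)
  finally show ?thesis using g(3) by simp
qed

text \<open>A monomial of total degree below \<open>2 * (m - 1)\<close> has an exponent below
  \<open>m - 1\<close>, so its double sum vanishes. The monomial in front lets the induction expand
  one affine factor at a time.\<close>

lemma sum_monomial_prod_affine:
  fixes a b c :: "'b \<Rightarrow> 'a"
  assumes card: "card (power_fixed m :: 'a set) = m"
    and "finite A" and "i + l + card A < 2 * (m - 1)"
  shows "(\<Sum>u\<in>power_fixed m. \<Sum>v\<in>power_fixed m.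
    u ^ i * v ^ l * (\<Prod>x\<in>A. a x + u * b x + v * c x)) = 0"
  using assms(2,3)
proof (induction A arbitrary: i l rule: finite_induct)
  case empty
  let ?K = "power_fixed m :: 'a set"
  have "i < m - 1 \<or> l < m - 1" using empty by auto
  then have "(\<Sum>u\<in>?K. u ^ i) * (\<Sum>v\<in>?K. v ^ l) = 0"
    using sum_power_power_fixed[OF card] by auto
  then show ?case by (simp add: sum_product)
next
  case (insert x A)
  let ?K = "power_fixed m :: 'a set"
  let ?F = "\<lambda>u v. \<Prod>x\<in>A. a x + u * b x + v * c x"
  have "u ^ i * v ^ l * (\<Prod>x\<in>insert x A. a x + u * b x + v * c x) =
    a x * (u ^ i * v ^ l * ?F u v) + b x * (u ^ Suc i * v ^ l * ?F u v)
    + c x * (u ^ i * v ^ Suc l * ?F u v)" for u v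
    using insert.hyps by (simp add: ring_distribs mult_ac)
  then have "(\<Sum>u\<in>?K. \<Sum>v\<in>?K. u ^ i * v ^ l * (\<Prod>x\<in>insert x A. a x + u * b x + v * c x))
    = a x * (\<Sum>u\<in>?K. \<Sum>v\<in>?K. u ^ i * v ^ l * ?F u v)
    + b x * (\<Sum>u\<in>?K. \<Sum>v\<in>?K. u ^ Suc i * v ^ l * ?F u v)
    + c x * (\<Sum>u\<in>?K. \<Sum>v\<in>?K. u ^ i * v ^ Suc l * ?F u v)"
    by (simp only: sum.distrib sum_distrib_left)
  then show ?case
    using insert.IH[of i l] insert.IH[of "Suc i" l] insert.IH[of i "Suc l"] insert.prems insert.hyps
    by simp
qed

text \<open>This is the degree bound of Jamison and of Brouwer and Schrijver for the bivariate
  polynomial \<open>\<Prod>x\<in>A. a x + u * b x + v * c x\<close>: a function on \<open>K\<^sup>2\<close> supported at the origin has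
  nonzero sum, while a polynomial of degree less than \<open>2 * (m - 1)\<close> has sum zero.\<close>

lemma exists_nonzero_prod_affine:
  fixes a b c :: "'b \<Rightarrow> 'a"
  assumes card: "card (power_fixed m :: 'a set) = m"
    and A: "finite A" "card A < 2 * (m - 1)" and nz: "\<And>x. x \<in> A \<Longrightarrow> a x \<noteq> 0"
  shows "\<exists>u\<in>power_fixed m. \<exists>v\<in>power_fixed m. (u, v) \<noteq> (0, 0) \<and>
    (\<forall>x\<in>A. a x + u * b x + v * c x \<noteq> 0)"
proof (rule ccontr)
  assume no: "\<not> ?thesis"
  let ?K = "power_fixed m :: 'a set"
  let ?F = "\<lambda>u v. \<Prod>x\<in>A. a x + u * b x + v * c x"
  have z: "?F u v = 0" if "u \<in> ?K" "v \<in> ?K" "(u, v) \<noteq> (0, 0)" for u v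
    using that no prod_zero_iff[OF A(1)] by blast
  have "0 = (\<Sum>u\<in>?K. \<Sum>v\<in>?K. ?F u v)"
    using sum_monomial_prod_affine[OF card A(1), of 0 0 a b c] A(2) by simp
  also have "\<dots> = (\<Sum>w\<in>?K \<times> ?K. ?F (fst w) (snd w))"
    by (simp add: sum.cartesian_product case_prod_unfold)
  also have "\<dots> = (\<Sum>w\<in>{(0, 0)}. ?F (fst w) (snd w))"
    using power_fixed_0 finite_power_fixed z
    by (intro sum.mono_neutral_right) (auto simp del: prod_zero_iff, metis, metis)
  also have "\<dots> = (\<Prod>x\<in>A. a x)" by simp
  finally show False using nz A(1) by (simp add: prod_zero_iff)
qed

end

text \<open>The polynomial \<open>X ^ m - X\<close> splits into linear factors, and its derivative
  is the constant \<open>-1\<close>, so none of its \<open>m\<close> roots is multiple.\<close>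

lemma card_power_fixed_alg_closed:
  assumes "prime CHAR('a::alg_closed_field)" and "m = CHAR('a) ^ j" and "j \<ge> 1"
  shows "card (power_fixed m :: 'a set) = m"
proof -
  let ?P = "monom 1 m - monom 1 1 :: 'a poly"
  have m1: "m > 1" using power_fixed_gt_1[OF assms] .
  have m0: "of_nat m = (0 :: 'a)" using power_fixed_of_nat[OF assms] .
  have deg: "degree ?P = m"
    using m1 degree_add_eq_left[of "- monom 1 1 :: 'a poly" "monom 1 m"] by (simp add: degree_monom_eq)
  then have P0: "?P \<noteq> 0" using m1 by force
  obtain A where A: "size A = m" "?P = smult (lead_coeff ?P) (\<Prod>x\<in>#A. [:-x, 1:])"
    using alg_closed_imp_factorization[OF P0] deg by auto
  have lc: "lead_coeff ?P = 1" using deg m1 by simp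
  have P: "?P = (\<Prod>x\<in>#A. [:-x, 1:])" using A(2) unfolding lc by simp
  have roots: "set_mset A = power_fixed m"
  proof -
    have "poly ?P x = 0 \<longleftrightarrow> x \<in># A" for x
      unfolding P by (auto simp: poly_prod_mset prod_mset_zero_iff)
    then show ?thesis by (auto simp: power_fixed_def poly_monom)
  qed
  have "count A x = 1" if xA: "x \<in># A" for x
  proof (rule ccontr)
    assume "count A x \<noteq> 1"
    moreover obtain A' where A': "A = add_mset x A'"
      using multi_member_split[OF xA] by blast
    ultimately have "x \<in># A'" by (simp add: not_in_iff)
    then obtain A'' where "A' = add_mset x A''" using multi_member_split by metis
    with A' P have PD: "?P = [:-x, 1:] * ([:-x, 1:] * (\<Prod>x\<in>#A''. [:-x, 1:]))"
      by simp
    have "poly (pderiv (D * (D * R))) x = 0" if "poly D x = 0" for D R :: "'a poly"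
      using that by (simp add: pderiv_mult)
    from this[of "[:-x, 1:]"] have "poly (pderiv ?P) x = 0"
      unfolding PD by simp
    moreover have "pderiv ?P = - 1"
      using m0 by (simp add: pderiv_diff pderiv_monom)
    ultimately show False by simp
  qed
  then have "size A = card (set_mset A)"
    by (simp add: size_multiset_overloaded_eq)
  then show ?thesis using A(1) roots by simp
qed

section \<open>Vector subspaces and projective points over a finite field\<close>

lemma card_subspace:
  fixes U :: "('a::{field, finite} ^ 'n::finite) set"
  assumes "vec.subspace U"
  shows "card U = CARD('a) ^ vec.dim U"
proof -
  have *: "finite B \<Longrightarrow> vec.independent B \<Longrightarrow> card (vec.span B) = CARD('a) ^ card B"
    for B :: "('a ^ 'n) set"
  proof (induction B rule: finite_induct)
    case (insert b B)
    then have b: "b \<notin> vec.span B" and B: "vec.independent B"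
      using vec.independent_insert[of b B] by auto
    let ?f = "\<lambda>(a, x). a *s b + x"
    have "inj_on ?f (UNIV \<times> vec.span B)"
    proof (rule inj_onI, clarify)
      fix a x a' x' assume x: "x \<in> vec.span B" "x' \<in> vec.span B" and eq: "a *s b + x = a' *s b + x'"
      have "(a - a') *s b = x' - x"
        using eq by (simp add: vec.scale_left_diff_distrib algebra_simps)
      then have "(a - a') *s b \<in> vec.span B"
        using x by (simp add: vec.span_diff)
      then have "inverse (a - a') *s ((a - a') *s b) \<in> vec.span B"
        by (rule vec.span_scale)
      moreover have "inverse (a - a') *s ((a - a') *s b) = b" if "a \<noteq> a'"
        using that by (simp only: vec.scale_scale left_inverse right_minus_eq vec.scale_one) simp
      ultimately have "a = a'"
        using b by metis
      then show "a = a' \<and> x = x'" using eq by simp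
    qed
    moreover have "?f ` (UNIV \<times> vec.span B) = vec.span (insert b B)"
    proof (intro equalityI subsetI)
      fix y assume "y \<in> vec.span (insert b B)"
      then obtain a where "y - a *s b \<in> vec.span B"
        by (auto simp: vec.span_breakdown_eq)
      then show "y \<in> ?f ` (UNIV \<times> vec.span B)"
        by (intro image_eqI[of _ _ "(a, y - a *s b)"]) auto
    next
      fix y assume "y \<in> ?f ` (UNIV \<times> vec.span B)"
      then obtain a x where "y = a *s b + x" "x \<in> vec.span B" by auto
      then show "y \<in> vec.span (insert b B)"
        unfolding vec.span_breakdown_eq by (intro exI[of _ a]) simp
    qed
    ultimately have "card (vec.span (insert b B)) = card ((UNIV :: 'a set) \<times> vec.span B)"
      by (metis card_image)
    then show ?case
      using insert B by (simp add: card_cartesian_product)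
  qed simp
  obtain B where B: "B \<subseteq> U" "vec.independent B" "U \<subseteq> vec.span B" "card B = vec.dim U"
    using vec.basis_exists by blast
  then have "U = vec.span B"
    using assms by (simp add: vec.span_minimal subset_antisym)
  then show ?thesis
    using *[of B] B by simp
qed

lemma subspace_between:
  fixes L W :: "('a::field ^ 'n::finite) set"
  assumes "vec.subspace L" "vec.subspace W" "L \<subseteq> W" "vec.dim L \<le> d" "d \<le> vec.dim W"
  obtains U where "vec.subspace U" "L \<subseteq> U" "U \<subseteq> W" "vec.dim U = d"
proof -
  obtain B where B: "B \<subseteq> L" "vec.independent B" "L \<subseteq> vec.span B" "card B = vec.dim L"
    using vec.basis_exists by blast
  obtain C where C: "B \<subseteq> C" "C \<subseteq> W" "vec.independent C" "W \<subseteq> vec.span C"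
    using vec.maximal_independent_subset_extend[of B W] B assms(3) by blast
  have "card C = vec.dim W"
    using C vec.basis_card_eq_dim by blast
  then obtain D where D: "B \<subseteq> D" "D \<subseteq> C" "card D = d"
    using exists_subset_between[of B d C] assms B C vec.finiteI_independent by metis
  show thesis
  proof
    show "vec.subspace (vec.span D)" by simp
    show "L \<subseteq> vec.span D" using B D vec.span_mono by blast
    show "vec.span D \<subseteq> W" using C D assms(2) by (simp add: vec.span_minimal)
    show "vec.dim (vec.span D) = d"
      using D C vec.independent_mono vec.dim_span_eq_card_independent by metis
  qed
qed

lemma exists_functional:
  fixes L :: "('a::field ^ 'n::finite) set"
  assumes "vec.subspace L" "x \<notin> L"
  obtains g :: "'a ^ 'n \<Rightarrow> 'a" where "\<And>u v. g (u + v) = g u + g v" "\<And>a u. g (a *s u) = a * g u"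
    "g x = 1" "\<And>u. u \<in> L \<Longrightarrow> g u = 0"
proof -
  obtain B where B: "B \<subseteq> L" "vec.independent B" "L \<subseteq> vec.span B" "card B = vec.dim L"
    using vec.basis_exists by blast
  then have "vec.span B = L"
    using assms(1) by (simp add: vec.span_minimal subset_antisym)
  then have ind: "vec.independent (insert x B)"
    using B assms(2) by (simp add: vec.independent_insert)
  \<comment> \<open>The functional is read off as one coordinate, \<open>i\<close> being arbitrary,
    of a linear extension with values in \<open>'a ^ 'n\<close>.\<close>
  fix i :: 'n
  obtain G where G: "Vector_Spaces.linear (*s) (*s) G"
    "\<And>v. v \<in> insert x B \<Longrightarrow> G v = (if v = x then axis i 1 else 0 :: 'a ^ 'n)"
    using vec.linear_independent_extend[OF ind, of "\<lambda>v. if v = x then axis i 1 else 0"] by blast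
  have "G v = 0" if "v \<in> B" for v
    using G(2)[of v] that B(1) assms(2) by auto
  then have "G u = 0" if "u \<in> L" for u
    using vec.linear_eq_0_on_span[OF G(1), of B u] that B(3) by blast
  then show thesis
    using that[of "\<lambda>v. G v $ i"] G(2)[of x] vec.linear_add[OF G(1)] vec.linear_scale[OF G(1)]
    by simp
qed

section \<open>Representative vectors and the number of points of a subspace\<close>

definition point_vec :: "('a::field, 'n::finite) proj_point \<Rightarrow> 'a ^ 'n" where
  "point_vec P = (SOME v. v \<in> Rep_proj_point P \<and> v \<noteq> 0)"

lemma Rep_proj_point_eq_span:
  fixes P :: "('a::field, 'n::finite) proj_point"
  assumes "v \<in> Rep_proj_point P" "v \<noteq> 0"
  shows "Rep_proj_point P = vec.span {v}"
proof -
  have P: "vec.subspace (Rep_proj_point P)" "vec.dim (Rep_proj_point P) = 1"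
    using Rep_proj_point[of P] by auto
  have "vec.dim (vec.span {v}) = 1"
    using assms(2) by (subst vec.dim_span_eq_card_independent) auto
  then show ?thesis
    using P assms vec.subspace_dim_equal[of "vec.span {v}" "Rep_proj_point P"]
    by (simp add: vec.span_minimal)
qed

lemma point_vec:
  fixes P :: "('a::field, 'n::finite) proj_point"
  shows "point_vec P \<noteq> 0" and "Rep_proj_point P = vec.span {point_vec P}"
proof -
  have P: "vec.subspace (Rep_proj_point P)" "vec.dim (Rep_proj_point P) = 1"
    using Rep_proj_point[of P] by auto
  then have "\<not> Rep_proj_point P \<subseteq> {0}"
    by (metis vec.dim_eq_0 zero_neq_one)
  then have "\<exists>v. v \<in> Rep_proj_point P \<and> v \<noteq> 0" by blast
  then have "point_vec P \<in> Rep_proj_point P \<and> point_vec P \<noteq> 0"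
    unfolding point_vec_def by (rule someI_ex)
  then show "point_vec P \<noteq> 0" and "Rep_proj_point P = vec.span {point_vec P}"
    using Rep_proj_point_eq_span by blast+
qed

lemma points_of_iff: "vec.subspace U \<Longrightarrow> P \<in> points_of U \<longleftrightarrow> point_vec P \<in> U"
  unfolding points_of_def mem_Collect_eq point_vec(2)
  by (metis insert_subset empty_subsetI vec.span_minimal vec.span_superset subset_trans)

lemma exists_point:
  fixes v :: "'a::field ^ 'n::finite"
  assumes "v \<noteq> 0"
  obtains P where "Rep_proj_point P = vec.span {v}"
proof -
  have "vec.dim (vec.span {v}) = 1"
    using assms by (subst vec.dim_span_eq_card_independent) auto
  then show thesis
    using that[of "Abs_proj_point (vec.span {v})"] by (simp add: Abs_proj_point_inverse)
qed

lemma point_vec_in_span_iff: "point_vec P \<in> vec.span {point_vec R} \<longleftrightarrow> P = R"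
  by (metis Rep_proj_point_eq_span Rep_proj_point_inject insertI1 point_vec vec.span_base)

text \<open>The nonzero vectors of \<open>U\<close> are split by its points into classes of size
  \<open>q - 1\<close>.\<close>

lemma card_points_of:
  fixes U :: "('a::{field, finite} ^ 'n::finite) set"
  assumes U: "vec.subspace U"
  shows "card (points_of U) * (CARD('a) - 1) + 1 = CARD('a) ^ vec.dim U"
proof -
  have "U - {0} = (\<Union>P\<in>points_of U. Rep_proj_point P - {0})"
  proof (intro equalityI subsetI)
    fix v assume v: "v \<in> U - {0}"
    then obtain P where P: "Rep_proj_point P = vec.span {v}"
      using exists_point by blast
    then have "Rep_proj_point P \<subseteq> U"
      using v U by (simp add: vec.span_minimal)
    then show "v \<in> (\<Union>P\<in>points_of U. Rep_proj_point P - {0})"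
      using P v vec.span_base by (fastforce simp: points_of_def)
  qed (auto simp: points_of_def)
  moreover have "card (\<Union>P\<in>points_of U. Rep_proj_point P - {0})
    = (\<Sum>P\<in>points_of U. card (Rep_proj_point P - {0}))"
  proof (intro card_UN_disjoint ballI impI)
    fix P R :: "('a, 'n) proj_point" assume "P \<noteq> R"
    then show "(Rep_proj_point P - {0}) \<inter> (Rep_proj_point R - {0}) = {}"
      using Rep_proj_point_eq_span[of _ P] Rep_proj_point_eq_span[of _ R]
      by (metis (no_types, lifting) Diff_iff IntE Rep_proj_point_inject equals0I insertI1)
  qed auto
  moreover have "card (Rep_proj_point P - {0}) = CARD('a) - 1" for P :: "('a, 'n) proj_point"
  proof -
    have P: "vec.subspace (Rep_proj_point P)" "vec.dim (Rep_proj_point P) = 1"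
      using Rep_proj_point[of P] by auto
    then show ?thesis using card_subspace[OF P(1)] vec.subspace_0[OF P(1)] by simp
  qed
  ultimately have "card (U - {0}) = card (points_of U) * (CARD('a) - 1)" by simp
  moreover have "card (U - {0}) + 1 = card U"
    using vec.subspace_0[OF U] by (metis Suc_eq_plus1 card_Suc_Diff1 finite)
  ultimately show ?thesis using card_subspace[OF U] by simp
qed

lemma card_points_of_cong_1:
  fixes U :: "('a::{field, finite} ^ 'n::finite) set"
  assumes U: "vec.subspace U" and "vec.dim U \<ge> 1"
  shows "[card (points_of U) = 1] (mod CARD('a))"
proof -
  let ?q = "CARD('a)" and ?N = "card (points_of U)"
  have "?q \<ge> 1" by (simp add: Suc_leI)
  then have "?N * (?q - 1) + ?N = ?q * ?N"
    by (simp add: algebra_simps diff_mult_distrib2)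
  then have "?q * ?N + 1 = ?q ^ vec.dim U + ?N"
    using card_points_of[OF U] by linarith
  moreover obtain e where "?q ^ vec.dim U = ?q * e"
    using assms(2) by (metis dvd_power dvd_def Suc_le_eq One_nat_def)
  ultimately have "(?N + ?q * e) mod ?q = (1 + ?q * ?N) mod ?q"
    by (simp add: add.commute)
  then show ?thesis
    by (simp only: Cong.cong_def mod_mult_self2)
qed

section \<open>Linear maps into the extension field\<close>

text \<open>An \<open>'a\<close>-linear map into the field \<open>K\<close> with \<open>CARD('a) ^ k\<close> elements has a kernel of
  codimension at most \<open>k\<close>; such kernels are the traces on \<open>PG(n,q)\<close> of the hyperplanes
  of \<open>PG(n,q\<^sup>k)\<close>.\<close>

definition lin_maps ::
    "nat \<Rightarrow> ('a::{field, finite} ^ 'n::finite) set \<Rightarrow> ('a ^ 'n \<Rightarrow> 'a alg_closure) set" where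
  "lin_maps m L = {f. range f \<subseteq> power_fixed m \<and> (\<forall>x y. f (x + y) = f x + f y)
     \<and> (\<forall>a x. f (a *s x) = to_ac a * f x) \<and> (\<forall>x\<in>L. f x = 0)}"

context
  fixes p h k Q :: nat
  assumes p: "prime p" and card_a: "CARD('a::{field, finite}) = p ^ h" and h: "h \<ge> 1"
    and k: "k \<ge> 1" and Q: "Q = CARD('a) ^ k"
begin

lemma CHAR_extension_field: "CHAR('a alg_closure) = p"
  using CHAR_finite_field[OF p card_a] by simp

lemma extension_field_order: "prime CHAR('a alg_closure)" "Q = CHAR('a alg_closure) ^ (h * k)" "h * k \<ge> 1"
  using p h k unfolding CHAR_extension_field by (simp_all add: Q card_a power_mult)

lemmas extension_field_closed =
  power_fixed_add[OF extension_field_order] power_fixed_0[OF extension_field_order]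
  power_fixed_uminus[OF extension_field_order] power_fixed_mult[OF extension_field_order]

lemma card_extension_field: "card (power_fixed Q :: 'a alg_closure set) = Q"
  using card_power_fixed_alg_closed[OF extension_field_order] .

lemma to_ac_power_fixed: "to_ac (a :: 'a) \<in> power_fixed Q"
proof -
  have "a ^ (CARD('a) ^ i) = a" for i
    by (induction i) (simp_all add: power_mult power_card_field)
  then show ?thesis
    by (simp add: power_fixed_def Q flip: to_ac_power)
qed

lemma finite_lin_maps: "finite (lin_maps Q L :: ('a ^ 'n::finite \<Rightarrow> _) set)"
proof (rule finite_subset)
  show "lin_maps Q L \<subseteq> (UNIV :: ('a ^ 'n) set) \<rightarrow>\<^sub>E power_fixed Q"
    by (auto simp: lin_maps_def)
  show "finite ((UNIV :: ('a ^ 'n) set) \<rightarrow>\<^sub>E (power_fixed Q :: 'a alg_closure set))"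
    using finite_power_fixed[OF extension_field_order] by (intro finite_PiE) auto
qed

lemma lin_maps_nonempty: "lin_maps Q L \<noteq> ({} :: ('a ^ 'n::finite \<Rightarrow> _) set)"
proof -
  have "(\<lambda>_. 0) \<in> lin_maps Q L"
    using extension_field_closed(2) by (auto simp: lin_maps_def)
  then show ?thesis by blast
qed

lemma lin_maps_add_functional:
  fixes f :: "'a ^ 'n::finite \<Rightarrow> 'a alg_closure"
  assumes "f \<in> lin_maps Q L" and "u \<in> power_fixed Q"
    and "\<And>x y. g (x + y) = g x + g y" "\<And>a x. g (a *s x) = a * g x" "\<And>x. x \<in> L \<Longrightarrow> g x = 0"
  shows "(\<lambda>x. f x + u * to_ac (g x)) \<in> lin_maps Q L"
  using assms to_ac_power_fixed extension_field_closed
  by (auto simp: lin_maps_def algebra_simps image_subset_iff)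

text \<open>With a functional \<open>g\<close> that vanishes on \<open>L\<close> and has
  \<open>g x = 1\<close>, each map \<open>f\<close> is uniquely a map vanishing at \<open>x\<close>
  plus \<open>f x\<close> times \<open>g\<close>. So evaluation at \<open>x\<close> takes each of
  the \<open>Q\<close> values equally often.\<close>

lemma card_lin_maps:
  fixes L :: "('a ^ 'n::finite) set"
  assumes L: "vec.subspace L" "x \<notin> L"
  shows "card (lin_maps Q L) = Q * card {f \<in> lin_maps Q L. f x = 0}"
proof -
  obtain g where g: "\<And>u v. g (u + v) = g u + g v" "\<And>a u. g (a *s u) = a * g u"
    "g x = 1" "\<And>u. u \<in> L \<Longrightarrow> g u = 0"
    using exists_functional[OF L] by metis
  note add = lin_maps_add_functional[OF _ _ g(1,2,4)]
  let ?K = "power_fixed Q :: 'a alg_closure set" and ?Z = "{f \<in> lin_maps Q L. f x = 0}"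
  have "bij_betw (\<lambda>(u, f). \<lambda>v. f v + u * to_ac (g v)) (?K \<times> ?Z) (lin_maps Q L)"
  proof (rule bij_betwI[where g = "\<lambda>f. (f x, \<lambda>v. f v + (- f x) * to_ac (g v))"])
    show "(\<lambda>f. (f x, \<lambda>v. f v + (- f x) * to_ac (g v))) \<in> lin_maps Q L \<rightarrow> ?K \<times> ?Z"
    proof
      fix f assume f: "f \<in> lin_maps Q L"
      then have fx: "f x \<in> ?K" by (auto simp: lin_maps_def)
      show "(f x, \<lambda>v. f v + (- f x) * to_ac (g v)) \<in> ?K \<times> ?Z"
        using add[OF f extension_field_closed(3)[OF fx]] fx g(3) by simp
    qed
  qed (use add g(3) in auto)
  then have "card (lin_maps Q L) = card (?K \<times> ?Z)"
    by (simp add: bij_betw_same_card)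
  then show ?thesis
    by (simp add: card_cartesian_product card_extension_field)
qed

text \<open>Averaging over \<open>lin_maps Q L\<close>: every vector outside \<open>L\<close> is in the kernel of exactly a fraction
  \<open>1 / Q\<close> of these maps.\<close>

lemma exists_lin_map_small_kernel:
  fixes L :: "('a ^ 'n::finite) set" and w :: "'b \<Rightarrow> 'a ^ 'n"
  assumes L: "vec.subspace L" and A: "finite A" "card A < 2 * Q" "\<And>P. P \<in> A \<Longrightarrow> w P \<notin> L"
  shows "\<exists>f\<in>lin_maps Q L. card {P \<in> A. f (w P) = 0} \<le> 1"
proof (rule ccontr)
  assume no: "\<not> ?thesis"
  let ?M = "lin_maps Q L"
  have two: "2 \<le> card {P \<in> A. f (w P) = 0}" if "f \<in> ?M" for f
    using no that by force
  have pos: "card ?M > 0"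
    using finite_lin_maps lin_maps_nonempty by (metis card_gt_0_iff)
  \<comment> \<open>Incidences between maps and vectors of \<open>A\<close> are counted twice; the
    factor \<open>Q\<close> avoids a division.\<close>
  have "Q * (\<Sum>f\<in>?M. card {P \<in> A. f (w P) = 0}) = Q * (\<Sum>P\<in>A. card {f \<in> ?M. f (w P) = 0})"
    using sum_multicount_gen[OF finite_lin_maps[of L] A(1), of "\<lambda>f P. f (w P) = 0"] by simp
  also have "\<dots> = (\<Sum>P\<in>A. card ?M)"
    using card_lin_maps[OF L A(3)] by (simp add: sum_distrib_left)
  also have "\<dots> < 2 * Q * card ?M"
    using A(2) pos by simp
  also have "\<dots> = Q * (\<Sum>f\<in>?M. 2)" by simp
  also have "\<dots> \<le> Q * (\<Sum>f\<in>?M. card {P \<in> A. f (w P) = 0})"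
    using two by (intro mult_left_mono sum_mono) auto
  finally show False by simp
qed

text \<open>Nonempty fibres are translates of the kernel and there are at most \<open>Q\<close> of
  them, so the dimension bound follows by counting vectors.\<close>

lemma kernel_lin_map:
  fixes f :: "'a ^ 'n::finite \<Rightarrow> 'a alg_closure"
  assumes f: "f \<in> lin_maps Q L"
  shows "vec.subspace {v. f v = 0}" and "CARD('n) \<le> vec.dim {v. f v = 0} + k"
proof -
  have add: "f (x + y) = f x + f y" and scale: "f (a *s x) = to_ac a * f x"
    and K: "f x \<in> power_fixed Q" for x y a
    using f by (auto simp: lin_maps_def)
  have f0: "f 0 = 0" using scale[of 0 0] by simp
  have diff: "f (x - y) = f x - f y" for x y
    using add[of "x - y" y] by simp
  show sub: "vec.subspace {v. f v = 0}"
    by (rule vec.subspaceI) (auto simp: add scale f0)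
  let ?W = "{v. f v = 0}"
  have fib: "card {v. f v = y} \<le> card ?W" for y
  proof (cases "\<exists>v. f v = y")
    case True
    then obtain v0 where v0: "f v0 = y" by blast
    show ?thesis
      by (rule card_inj_on_le[where f = "\<lambda>v. v - v0"]) (auto simp: diff v0 inj_on_def)
  qed auto
  have "(UNIV :: ('a ^ 'n) set) = (\<Union>y\<in>power_fixed Q. {v. f v = y})"
    using K by auto
  then have "CARD('a ^ 'n) \<le> (\<Sum>y\<in>power_fixed Q. card {v. f v = y})"
    using card_UN_le[OF finite_power_fixed[OF extension_field_order]] by metis
  also have "\<dots> \<le> Q * card ?W"
    using sum_bounded_above[of "power_fixed Q" "\<lambda>y. card {v. f v = y}"] fib card_extension_field by simp
  also have "\<dots> = CARD('a) ^ (k + vec.dim ?W)"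
    using card_subspace[OF sub] by (simp add: Q power_add)
  finally have "CARD('a) ^ CARD('n) \<le> CARD('a) ^ (k + vec.dim ?W)"
    by simp
  moreover have "CARD('a) > 1"
    using p h card_a by (metis one_less_power less_le_trans prime_gt_1_nat zero_less_one)
  ultimately show "CARD('n) \<le> vec.dim ?W + k"
    by simp
qed

text \<open>The linear dimension \<open>CARD('n) - k\<close> is projective dimension
  \<open>n - k\<close>, that of the spaces on which the codeword is constant.\<close>

lemma subspace_in_kernel:
  fixes f :: "'a ^ 'n::finite \<Rightarrow> 'a alg_closure"
  assumes f: "f \<in> lin_maps Q L" and L: "vec.subspace L" "vec.dim L + k \<le> CARD('n)"
  obtains U where "vec.subspace U" "L \<subseteq> U" "U \<subseteq> {v. f v = 0}" "vec.dim U = CARD('n) - k"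
proof -
  have "L \<subseteq> {v. f v = 0}" using f by (auto simp: lin_maps_def)
  then show thesis
    using subspace_between[OF L(1) kernel_lin_map(1)[OF f], of "CARD('n) - k"]
      kernel_lin_map(2)[OF f] L(2) that by (metis add_le_imp_le_diff le_diff_conv)
qed

end

section \<open>Codewords of small weight\<close>

lemma points_of_Int: "points_of U \<inter> points_of W = points_of (U \<inter> W)"
  by (auto simp: points_of_def)

lemma points_of_mono: "U \<subseteq> W \<Longrightarrow> points_of U \<subseteq> points_of W"
  by (auto simp: points_of_def)

lemma sum_on_eq_sum_supp: "sum_on c S = (\<Sum>P\<in>S \<inter> supp c. c $ P)"
  unfolding sum_on_def by (rule sum.mono_neutral_right) (auto simp: supp_def)

lemma sum_on_incidence_vec:
  "sum_on (incidence_vec S :: 'f::comm_semiring_1 ^ 'i::finite) T = of_nat (card (S \<inter> T))"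
proof -
  have "(\<Sum>P\<in>T. if P \<in> S then 1 else 0 :: 'f) = of_nat (card (T \<inter> S))"
    by (simp add: sum.If_cases)
  then show ?thesis
    by (simp add: sum_on_def incidence_vec_def Int_commute)
qed

text \<open>A \<open>k\<close>-space meets every \<open>(n-k)\<close>-space in \<open>1\<close> modulo \<open>p\<close> points, so on a codeword all
  \<open>(n-k)\<close>-spaces take the same value.\<close>

lemma sum_on_subspace_code_eq:
  fixes c :: "'f::{field, finite} ^ ('a::{field, finite}, 'n::finite) proj_point"
  assumes p: "prime p" and h: "h \<ge> 1" "CARD('a) = p ^ h" and f: "CARD('f) = p"
    and c: "c \<in> subspace_code k" and k: "k \<le> CARD('n)"
    and U: "vec.subspace U" "vec.dim U = CARD('n) - k"
    and W: "vec.subspace W" "vec.dim W = CARD('n) - k"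
  shows "sum_on c (points_of U) = sum_on c (points_of W)"
proof -
  have CHAR: "CHAR('f) = p"
    using CHAR_finite_field[of p 1, where 'a = 'f] p f by simp
  have 1: "sum_on (incidence_vec (points_of V) :: 'f ^ ('a, 'n) proj_point) (points_of Y) = 1"
    if V: "vec.subspace V" "vec.dim V = k + 1" and Y: "vec.subspace Y" "vec.dim Y = CARD('n) - k"
    for V Y :: "('a ^ 'n) set"
  proof -
    \<comment> \<open>The dimensions of \<open>V\<close> and \<open>Y\<close> add up to
      \<open>CARD('n) + 1\<close>, so the two spaces share a point.\<close>
    have "vec.dim {x + y |x y. x \<in> V \<and> y \<in> Y} + vec.dim (V \<inter> Y) = vec.dim V + vec.dim Y"
      by (rule vec.dim_sums_Int[OF V(1) Y(1)])
    moreover have "vec.dim {x + y |x y. x \<in> V \<and> y \<in> Y} \<le> CARD('n)"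
      by (rule dim_subset_UNIV_cart_gen)
    ultimately have "vec.dim (V \<inter> Y) \<ge> 1"
      using V(2) Y(2) k by linarith
    then have "[card (points_of (V \<inter> Y)) = 1] (mod CARD('a))"
      using card_points_of_cong_1 vec.subspace_inter[OF V(1) Y(1)] by blast
    then have "[card (points_of (V \<inter> Y)) = 1] (mod p)"
      using h by (metis cong_dvd_modulus_nat dvd_power Suc_le_eq One_nat_def)
    then have "of_nat (card (points_of (V \<inter> Y))) = (of_nat 1 :: 'f)"
      by (simp only: of_nat_eq_iff_cong_CHAR CHAR)
    then show ?thesis
      by (simp add: sum_on_incidence_vec points_of_Int)
  qed
  have "vec.span (incidence_vec ` proj_subspaces_dim k)
    \<subseteq> {c :: 'f ^ ('a, 'n) proj_point. sum_on c (points_of U) = sum_on c (points_of W)}"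
  proof (rule vec.span_minimal)
    show "vec.subspace {c :: 'f ^ ('a, 'n) proj_point. sum_on c (points_of U) = sum_on c (points_of W)}"
      by (rule vec.subspaceI) (auto simp: sum_on_def sum.distrib simp flip: sum_distrib_left)
    show "incidence_vec ` proj_subspaces_dim k
      \<subseteq> {c :: 'f ^ ('a, 'n) proj_point. sum_on c (points_of U) = sum_on c (points_of W)}"
      using 1 U W by (auto simp: proj_subspaces_dim_def)
  qed
  then show ?thesis
    using c unfolding subspace_code_def by blast
qed

lemma dim_span_two_points:
  assumes "P \<noteq> R"
  shows "vec.dim (vec.span {point_vec P, point_vec R}) = 2"
proof -
  have notin: "point_vec P \<notin> vec.span {point_vec R}"
    using assms by (simp add: point_vec_in_span_iff)
  then have "point_vec P \<noteq> point_vec R"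
    using vec.span_base by fastforce
  moreover have "vec.independent {point_vec P, point_vec R}"
    using notin point_vec(1) by (simp add: vec.independent_insert)
  ultimately show ?thesis
    by (subst vec.dim_span_eq_card_independent) auto
qed

context
  fixes p h k Q :: nat
  assumes p: "prime p" and card_a: "CARD('a::{field, finite}) = p ^ h" and h: "h \<ge> 1"
    and k: "k \<ge> 1" and Q: "Q = CARD('a) ^ k"
begin

text \<open>If the coefficient at \<open>R\<close> differs from \<open>\<alpha>\<close>, there is an \<open>(n-k)\<close>-space meeting the support in
  just \<open>R\<close> and one more point \<open>S\<close>, the kernel of some \<open>f\<close>. Perturbing \<open>f\<close> by \<open>K\<close>-multiples of two
  functionals dual to \<open>S\<close> and \<open>R\<close> yields an \<open>(n-k)\<close>-space that meets the support in at most
  one of \<open>R\<close> and \<open>S\<close> and in no other point.\<close>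

lemma coeff_eq_const:
  fixes c :: "'f::field ^ ('a, 'n::finite) proj_point"
  assumes const: "\<And>U. vec.subspace U \<Longrightarrow> vec.dim U = CARD('n) - k \<Longrightarrow> sum_on c (points_of U) = \<alpha>"
    and "\<alpha> \<noteq> 0" and kn: "k + 1 \<le> CARD('n)" and wt: "weight c < 2 * Q" and R: "R \<in> supp c"
  shows "c $ R = \<alpha>"
proof (rule ccontr)
  assume neq: "c $ R \<noteq> \<alpha>"
  let ?v = point_vec
  note ctx = p card_a h k Q
  note extension_field_order = extension_field_order[OF ctx]
  let ?L = "vec.span {?v R}"
  have dimL: "vec.dim ?L = 1"
    using point_vec(1)[of R] by (subst vec.dim_span_eq_card_independent) auto
  have notL: "?v P \<notin> ?L" if "P \<in> supp c - {R}" for P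
    using that by (simp add: point_vec_in_span_iff)
  have "card (supp c - {R}) < 2 * Q"
    using wt unfolding weight_def by (metis card_Diff1_le le_less_trans)
  then obtain f where f: "f \<in> lin_maps Q ?L" "card {P \<in> supp c - {R}. f (?v P) = 0} \<le> 1"
    using exists_lin_map_small_kernel[OF ctx vec.subspace_span[of "{?v R}"], of "supp c - {R}" ?v] notL
    by auto
  obtain U where U: "vec.subspace U" "?L \<subseteq> U" "U \<subseteq> {v. f v = 0}" "vec.dim U = CARD('n) - k"
    using subspace_in_kernel[OF ctx f(1)] dimL kn by (metis vec.subspace_span add.commute)
  have RU: "R \<in> points_of U"
    using U vec.span_base by (fastforce simp: points_of_iff)
  have Usub: "points_of U \<inter> supp c \<subseteq> insert R {P \<in> supp c - {R}. f (?v P) = 0}"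
    using U by (auto simp: points_of_iff)
  \<comment> \<open>Otherwise the sum over \<open>U\<close> would be the coefficient at
    \<open>R\<close> alone, which is not \<alpha>.\<close>
  have "points_of U \<inter> supp c \<noteq> {R}"
    using neq const[OF U(1,4)] by (auto simp: sum_on_eq_sum_supp)
  then obtain S where S: "S \<in> points_of U" "S \<in> supp c" "S \<noteq> R"
    using RU R by blast
  then have "S \<in> {P \<in> supp c - {R}. f (?v P) = 0}" using Usub by blast
  then have Z: "{P \<in> supp c - {R}. f (?v P) = 0} = {S}"
    using f(2) card_le_Suc0_iff_eq[of "{P \<in> supp c - {R}. f (?v P) = 0}"]
    by (intro equalityI subsetI) auto
  then have "points_of U \<inter> supp c = {R, S}"
    using Usub S RU R by auto
  then have cS: "c $ R + c $ S = \<alpha>"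
    using const[OF U(1,4)] S by (simp add: sum_on_eq_sum_supp)
  have cS_neq: "c $ S \<noteq> \<alpha>"
    using cS R by (auto simp: supp_def)
  have vR: "?v R \<in> ?L" and vS: "?v S \<in> vec.span {?v S}"
    by (simp_all add: vec.span_base)
  have fR: "f (?v R) = 0"
    using f(1) vR unfolding lin_maps_def by blast
  have fS: "f (?v S) = 0"
    using Z by blast
  have "?v S \<notin> ?L" and "?v R \<notin> vec.span {?v S}"
    using S by (auto simp: point_vec_in_span_iff)
  obtain g1 where g1: "\<And>u v. g1 (u + v) = g1 u + g1 v" "\<And>a u. g1 (a *s u) = a * g1 u"
    "g1 (?v S) = 1" "\<And>u. u \<in> ?L \<Longrightarrow> g1 u = 0"
    using exists_functional[OF vec.subspace_span \<open>?v S \<notin> ?L\<close>] by metis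
  obtain g2 where g2: "\<And>u v. g2 (u + v) = g2 u + g2 v" "\<And>a u. g2 (a *s u) = a * g2 u"
    "g2 (?v R) = 1" "\<And>u. u \<in> vec.span {?v S} \<Longrightarrow> g2 u = 0"
    using exists_functional[OF vec.subspace_span \<open>?v R \<notin> vec.span {?v S}\<close>] by metis
  let ?A = "supp c - {R, S}"
  have "card ?A = card (supp c) - 2"
    using S R by (simp add: card_Diff_subset)
  \<comment> \<open>Dropping the two points \<open>R\<close> and \<open>S\<close> turns the weight
    bound \<open>2 * Q\<close> into exactly the degree bound \<open>2 * (Q - 1)\<close>.\<close>
  then have cardA: "card ?A < 2 * (Q - 1)"
  proof -
    have "card {R, S} \<le> card (supp c)"
      using S R by (intro card_mono) auto
    then show ?thesis
      using \<open>card ?A = card (supp c) - 2\<close> wt S(3) by (simp add: weight_def)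
  qed
  have nz: "f (?v P) \<noteq> 0" if "P \<in> ?A" for P
    using that Z by auto
  have "\<exists>a\<in>power_fixed Q. \<exists>b\<in>power_fixed Q. (a, b) \<noteq> (0, 0) \<and>
    (\<forall>P\<in>?A. f (?v P) + a * to_ac (g1 (?v P)) + b * to_ac (g2 (?v P)) \<noteq> 0)"
    using cardA
    by (intro exists_nonzero_prod_affine[OF extension_field_order card_extension_field[OF ctx]] nz)
      simp_all
  then obtain a b where ab: "a \<in> power_fixed Q" "b \<in> power_fixed Q" "(a, b) \<noteq> (0, 0)"
    and ab_nz: "\<forall>P\<in>?A. f (?v P) + a * to_ac (g1 (?v P)) + b * to_ac (g2 (?v P)) \<noteq> 0"
    by blast
  define F where "F = (\<lambda>x. f x + a * to_ac (g1 x) + b * to_ac (g2 x))"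
  \<comment> \<open>The subspace is relaxed to \<open>{0}\<close> because the perturbed map need not
    vanish at \<open>R\<close>.\<close>
  have "f \<in> lin_maps Q {0}"
    using f(1) vec.span_zero[of "{?v R}"] by (auto simp: lin_maps_def)
  moreover have "g1 0 = 0" "g2 0 = 0"
    using g1(2)[of 0 0] g2(2)[of 0 0] by simp_all
  ultimately have "F \<in> lin_maps Q {0}"
    unfolding F_def using ab(1,2) g1(1,2) g2(1,2) by (intro lin_maps_add_functional[OF ctx]) auto
  then obtain W where W: "vec.subspace W" "W \<subseteq> {v. F v = 0}" "vec.dim W = CARD('n) - k"
    using subspace_in_kernel[OF ctx, of F "{0}"] kn by auto
  have "points_of W \<inter> supp c \<subseteq> {R, S}"
    using W ab_nz by (auto simp: points_of_iff F_def)
  \<comment> \<open>By duality of \<open>g1\<close> and \<open>g2\<close> the pair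
    \<open>(a, b)\<close> gives the values of \<open>F\<close> at \<open>S\<close> and
    \<open>R\<close>; since it is nonzero, the kernel misses one of them.\<close>
  moreover have "F (?v R) = b" "F (?v S) = a"
    using fR fS g1(3) g1(4)[OF vR] g2(3) g2(4)[OF vS] by (simp_all add: F_def)
  then have "\<not> {R, S} \<subseteq> points_of W"
    using W ab(3) by (auto simp: points_of_iff)
  ultimately have "points_of W \<inter> supp c \<in> {{}, {R}, {S}}" by blast
  moreover have "(\<Sum>P\<in>points_of W \<inter> supp c. c $ P) = \<alpha>"
    using const[OF W(1,3)] by (simp add: sum_on_eq_sum_supp)
  \<comment> \<open>The sum over \<open>W\<close> would be zero or a single coefficient at
    \<open>R\<close> or \<open>S\<close>, and none of these equals \<alpha>.\<close>
  ultimately show False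
    using neq cS_neq \<open>\<alpha> \<noteq> 0\<close> by auto
qed

section \<open>Sets meeting all subspaces of codimension \<open>k\<close> in 1 modulo
  \<open>p\<close> points\<close>

context
  fixes B :: "('a, 'n::finite) proj_point set"
  assumes B: "card B < 2 * Q" and kn: "k + 2 \<le> CARD('n)" and p2: "p > 2"
    and B1: "\<And>U. vec.subspace U \<Longrightarrow> vec.dim U = CARD('n) - k \<Longrightarrow>
      [card (points_of U \<inter> B) = 1] (mod p)"
begin

text \<open>Averaging gives a subspace \<open>U\<close> of codimension \<open>k\<close> through
  \<open>L\<close> with at most one point of \<open>B\<close> outside \<open>L\<close>. As
  \<open>U\<close> meets \<open>B\<close> in 1 modulo \<open>p\<close> points, \<open>L\<close> does
  so too if there is no extra point, and otherwise has one point fewer.\<close>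

lemma line_cong_or_extension:
  assumes L: "vec.subspace L" "vec.dim L = 2"
  shows "[card (points_of L \<inter> B) = 1] (mod p) \<or>
    p dvd card (points_of L \<inter> B) \<and>
    (\<exists>U S. vec.subspace U \<and> L \<subseteq> U \<and> S \<notin> points_of L \<and>
      points_of U \<inter> B = insert S (points_of L \<inter> B))"
proof -
  note ctx = p card_a h k Q
  let ?A = "B - points_of L"
  have "card ?A < 2 * Q"
    using B by (metis card_mono finite Diff_subset le_less_trans)
  then obtain f where f: "f \<in> lin_maps Q L" "card {P \<in> ?A. f (point_vec P) = 0} \<le> 1"
    using exists_lin_map_small_kernel[OF ctx L(1), of ?A point_vec] points_of_iff[OF L(1)] by auto
  obtain U where U: "vec.subspace U" "L \<subseteq> U" "U \<subseteq> {v. f v = 0}" "vec.dim U = CARD('n) - k"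
    using subspace_in_kernel[OF ctx f(1) L(1)] L(2) kn by (metis add.commute)
  let ?E = "{P \<in> ?A. P \<in> points_of U}"
  have UB: "points_of U \<inter> B = ?E \<union> (points_of L \<inter> B)"
    using points_of_mono[OF U(2)] by auto
  have "card ?E \<le> card {P \<in> ?A. f (point_vec P) = 0}"
    using U by (intro card_mono) (auto simp: points_of_iff)
  then have "card ?E = 0 \<or> card ?E = 1"
    using f(2) by linarith
  then show ?thesis
  proof
    assume "card ?E = 0"
    then have "points_of U \<inter> B = points_of L \<inter> B"
      using UB by auto
    then show ?thesis
      using B1[OF U(1,4)] by simp
  next
    assume "card ?E = 1"
    then obtain S where S: "?E = {S}"
      using card_1_singletonE by blast
    then have SL: "S \<notin> points_of L" by blast
    have US: "points_of U \<inter> B = insert S (points_of L \<inter> B)"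
      using UB S by auto
    then have "[card (points_of L \<inter> B) + 1 = 0 + 1] (mod p)"
      using B1[OF U(1,4)] SL by simp
    then have "p dvd card (points_of L \<inter> B)"
      by (simp only: cong_add_rcancel_nat cong_0_iff)
    then show ?thesis using U US SL by blast
  qed
qed

text \<open>Otherwise the line through \<open>R\<close> and the extra point \<open>S\<close> would meet \<open>B\<close> in exactly two
  points, and \<open>2\<close> is neither \<open>0\<close> nor \<open>1\<close> modulo \<open>p\<close>.\<close>

lemma line_cong:
  assumes L: "vec.subspace L" "vec.dim L = 2" and R: "R \<in> points_of L" "R \<in> B"
  shows "[card (points_of L \<inter> B) = 1] (mod p)"
proof (rule ccontr)
  assume "\<not> ?thesis"
  then obtain U S where U: "vec.subspace U" "L \<subseteq> U" and S: "S \<notin> points_of L"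
    "points_of U \<inter> B = insert S (points_of L \<inter> B)"
    using line_cong_or_extension[OF L] by blast
  let ?M = "vec.span {point_vec R, point_vec S}"
  have "R \<noteq> S" using R S by blast
  then have dimM: "vec.dim ?M = 2" by (rule dim_span_two_points)
  have RU: "point_vec R \<in> U" and SU: "point_vec S \<in> U"
    using R S U points_of_iff[OF U(1)] points_of_iff[OF L(1)] by auto
  then have "?M \<subseteq> U" using U(1) by (simp add: vec.span_minimal)
  \<comment> \<open>A second common point of \<open>?M\<close> and \<open>L\<close> would, by
    exchange, put \<open>S\<close> on \<open>L\<close>.\<close>
  have "P = R" if P: "P \<in> points_of ?M" "P \<in> points_of L" for P
  proof (rule ccontr)
    assume "P \<noteq> R"
    then have "point_vec P \<notin> vec.span {point_vec R}"
      by (simp add: point_vec_in_span_iff)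
    moreover have "point_vec P \<in> vec.span (insert (point_vec S) {point_vec R})"
      using P(1) by (simp add: points_of_iff insert_commute)
    ultimately have "point_vec S \<in> vec.span (insert (point_vec P) {point_vec R})"
      using vec.in_span_insert by blast
    also have "\<dots> \<subseteq> L"
      using P(2) R(1) L(1) by (intro vec.span_minimal) (auto simp: points_of_iff)
    finally show False using S(1) L(1) by (simp add: points_of_iff)
  qed
  then have "points_of ?M \<inter> B \<subseteq> {R, S}"
    using points_of_mono[OF \<open>?M \<subseteq> U\<close>] S(2) by blast
  moreover have "R \<in> points_of ?M" "S \<in> points_of ?M"
    by (simp_all add: points_of_iff vec.span_base)
  ultimately have "points_of ?M \<inter> B = {R, S}"
    using R S by blast
  then have "card (points_of ?M \<inter> B) = 2"
    using \<open>R \<noteq> S\<close> by simp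
  \<comment> \<open>The dichotomy is applied once more, now to \<open>?M\<close>, and only its
    congruences are kept.\<close>
  then have "[2 = 1] (mod p) \<or> p dvd 2"
    using line_cong_or_extension[OF vec.subspace_span dimM] by metis
  then show False
    using p2 by (auto simp: Cong.cong_def dest: dvd_imp_le)
qed

text \<open>The lines through \<open>R\<close> partition the other points of \<open>B\<close> in
  \<open>U\<close>. By \<open>line_cong\<close> each of them holds a multiple of \<open>p\<close>
  such points, and \<open>R\<close> itself supplies the remaining 1.\<close>

lemma subspace_cong:
  assumes U: "vec.subspace U" and R: "R \<in> points_of U" "R \<in> B"
  shows "[card (points_of U \<inter> B) = 1] (mod p)"
proof -
  let ?X = "points_of U \<inter> B - {R}"
  let ?l = "\<lambda>P. vec.span {point_vec P, point_vec R}"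
  have fib: "p dvd card {P' \<in> ?X. ?l P' = ?l P}" if P: "P \<in> ?X" for P
  proof -
    have dim: "vec.dim (?l P') = 2" if "P' \<noteq> R" for P'
      using that by (rule dim_span_two_points)
    have RP: "R \<in> points_of (?l P)"
      by (simp add: points_of_iff vec.span_base)
    have "?l P \<subseteq> U"
      using P R U by (intro vec.span_minimal) (auto simp: points_of_iff)
    have eq: "?l P' = ?l P" if P': "P' \<in> points_of (?l P)" "P' \<noteq> R" for P'
    proof (rule vec.subspace_dim_equal)
      show "?l P' \<subseteq> ?l P"
        using P' RP by (intro vec.span_minimal) (auto simp: points_of_iff)
      show "vec.dim (?l P) \<le> vec.dim (?l P')"
        using dim[of P] dim[of P'] P P' by simp
    qed simp_all
    have "P' \<in> points_of (?l P')" for P'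
      by (simp add: points_of_iff vec.span_base)
    then have "P' \<in> points_of (?l P)" if "?l P' = ?l P" for P'
      using that by metis
    then have "{P' \<in> ?X. ?l P' = ?l P} = points_of (?l P) \<inter> B - {R}"
    proof (intro equalityI subsetI)
      fix P' assume "P' \<in> points_of (?l P) \<inter> B - {R}"
      then show "P' \<in> {P' \<in> ?X. ?l P' = ?l P}"
        using eq[of P'] points_of_mono[OF \<open>?l P \<subseteq> U\<close>] by blast
    qed blast
    moreover have "card (points_of (?l P) \<inter> B) = card (points_of (?l P) \<inter> B - {R}) + 1"
      using RP R(2) by (metis IntI Suc_eq_plus1 card_Suc_Diff1 finite)
    moreover have "[card (points_of (?l P) \<inter> B) = 1] (mod p)"
      using line_cong[OF vec.subspace_span dim RP R(2)] P by blast
    ultimately have "[card {P' \<in> ?X. ?l P' = ?l P} + 1 = 0 + 1] (mod p)"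
      by simp
    then show ?thesis
      by (simp only: cong_add_rcancel_nat cong_0_iff)
  qed
  have "card ?X = (\<Sum>M\<in>?l ` ?X. card {P' \<in> ?X. ?l P' = M})"
    using sum.image_gen[of ?X "\<lambda>_. 1 :: nat" ?l] by simp
  moreover have "p dvd (\<Sum>M\<in>?l ` ?X. card {P' \<in> ?X. ?l P' = M})"
    using fib by (intro dvd_sum) blast
  ultimately have "p dvd card ?X" by simp
  moreover have "card (points_of U \<inter> B) = card ?X + 1"
    using R by (metis IntI Suc_eq_plus1 card_Suc_Diff1 finite)
  ultimately show ?thesis
    by (simp add: Cong.cong_def mod_Suc)
qed

end

end

theorem theorem3p4:
  fixes p h q n k :: nat
    and c :: "'f::{field, finite} ^ ('a::{field, finite}, 'n::finite) proj_point"
    and S T :: "('a, 'n) proj_point set"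
  assumes "prime p" and "p > 3" and "h \<ge> 1" and "q = p ^ h"
    and "n \<ge> 2" and "1 \<le> k" and "k \<le> n - 1"
    and "CARD('a) = q" and "CARD('n) = n + 1" and "CARD('f) = p"
    and "c \<in> subspace_code k"
    and "weight c < 2 * q ^ k"
    and "S \<in> proj_subspaces_dim (n - k)" and "sum_on c S \<noteq> 0"
    and "T \<in> proj_subspaces" and "T \<inter> supp c \<noteq> {}"
  shows "[card (T \<inter> supp c) = 1] (mod p)"
proof -
  have card_a: "CARD('a) = p ^ h" using assms by simp
  note ctx = \<open>prime p\<close> card_a \<open>h \<ge> 1\<close> \<open>1 \<le> k\<close> refl
  define \<alpha> where "\<alpha> = sum_on c S"
  have kn: "k + 2 \<le> CARD('n)" using assms by simp
  have CHAR: "CHAR('f) = p"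
    using CHAR_finite_field[of p 1, where 'a = 'f] assms by simp
  obtain U\<^sub>0 :: "('a ^ 'n) set" where U\<^sub>0: "vec.subspace U\<^sub>0" "vec.dim U\<^sub>0 = n - k + 1" "S = points_of U\<^sub>0"
    using assms(13) by (auto simp: proj_subspaces_dim_def)
  then have dim\<^sub>0: "vec.dim U\<^sub>0 = CARD('n) - k"
    using assms by simp
  have const: "sum_on c (points_of U) = \<alpha>" if "vec.subspace U" "vec.dim U = CARD('n) - k" for U
    unfolding \<alpha>_def U\<^sub>0(3)
    using sum_on_subspace_code_eq[OF \<open>prime p\<close> \<open>h \<ge> 1\<close> card_a \<open>CARD('f) = p\<close>
        \<open>c \<in> subspace_code k\<close> _ that U\<^sub>0(1) dim\<^sub>0]
      kn by simp
  have wt: "weight c < 2 * CARD('a) ^ k" using assms by simp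
  have coeff: "c $ R = \<alpha>" if "R \<in> supp c" for R
    using coeff_eq_const[OF ctx const _ _ wt that] assms(14) kn by (simp add: \<alpha>_def)
  have cong: "[card (points_of U \<inter> supp c) = 1] (mod p)"
    if "vec.subspace U" "vec.dim U = CARD('n) - k" for U
  proof -
    \<comment> \<open>All coefficients on the support equal \<alpha>, so the constant sum counts
      points; cancelling the nonzero \<alpha> leaves the congruence.\<close>
    have "of_nat (card (points_of U \<inter> supp c)) * \<alpha> = \<alpha>"
      using const[OF that] coeff by (simp add: sum_on_eq_sum_supp)
    then have "of_nat (card (points_of U \<inter> supp c)) = (of_nat 1 :: 'f)"
      using assms(14) by (simp add: \<alpha>_def)
    then show ?thesis
      by (simp only: of_nat_eq_iff_cong_CHAR CHAR)
  qed
  obtain U where U: "vec.subspace U" "T = points_of U"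
    using assms(15) by (auto simp: proj_subspaces_def)
  obtain R where R: "R \<in> points_of U" "R \<in> supp c"
    using assms(16) U by blast
  show ?thesis
    unfolding U(2)
    by (rule subspace_cong[OF ctx wt[unfolded weight_def] kn _ cong U(1) R]) (use assms(2) in simp_all)
qed

end
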